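(* Let $(\boldsymbol X_n)_{n\in\mathbb{N}}$ be a sequence of i.i.d. real random variables with distribution $P_X$, let $\boldsymbol X$ have distribution $P_X$, and suppose that the function $\xi(x)=\mathbb{E}\,g(\boldsymbol X-x)$ is finite for some $x\in\mathbb{R}$. Let $x^*:=\arg\min_{x\in\mathbb{R}}\xi(x)$ and define the random variables $$\overline{\boldsymbol X}_n := \arg\min_{x\in\mathbb{R}}\sum_{i=1}^n g(\boldsymbol X_i-x),\qquad n=1,2,\dots$$ Then $\overline{\boldsymbol X}_n$ converges to $x^*$ almost surely.
   Context: $g\colon\mathbb{R}\to\mathbb{R}$ is a strictly convex function that attains its minimum at $0$, with $g(0)=0$. The function $\xi$ takes values in $[0,+\infty]$. Each $\arg\min$ denotes the unique minimizer. *)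

theory Defs
  imports "HOL-Probability.Probability"
begin

definition strictly_convex :: "(real \<Rightarrow> real) \<Rightarrow> bool" where
  "strictly_convex g \<longleftrightarrow>
     (\<forall>x y t. x \<noteq> y \<longrightarrow> 0 < t \<longrightarrow> t < 1 \<longrightarrow>
        g ((1 - t) * x + t * y) < (1 - t) * g x + t * g y)"

text \<open>
  The library's \<open>arg_min\<close> picks an arbitrary minimizer; here the value is specified as
  the unique minimizer over the whole real line.
\<close>
definition argmin :: "(real \<Rightarrow> 'b::ord) \<Rightarrow> real" where
  "argmin f = (THE x. is_arg_min f (\<lambda>_. True) x)"

text \<open>
  The expectation of \<open>g (Y - x)\<close> as a value in \<open>[0, \<infinity>]\<close>. The coercion \<open>ennreal\<close> truncates
  negative numbers to 0, so this is the intended expectation only for nonnegative \<open>g\<close>.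
\<close>
definition expected_loss :: "(real \<Rightarrow> real) \<Rightarrow> 'a measure \<Rightarrow> ('a \<Rightarrow> real) \<Rightarrow> real \<Rightarrow> ennreal" where
  "expected_loss g N Y x = (\<integral>\<^sup>+ \<omega>. ennreal (g (Y \<omega> - x)) \<partial>N)"

definition empirical_argmin :: "(real \<Rightarrow> real) \<Rightarrow> (nat \<Rightarrow> 'a \<Rightarrow> real) \<Rightarrow> nat \<Rightarrow> 'a \<Rightarrow> real" where
  "empirical_argmin g X n \<omega> = argmin (\<lambda>x. \<Sum>i=1..n. g (X i \<omega> - x))"

end

theory Submission
  imports Defs
begin

section \<open>Minimizers of the expected loss\<close>

locale convex_loss =
  fixes g :: "real \<Rightarrow> real"
  assumes g_convex: "strictly_convex g"
    and g_min: "\<And>x. g 0 \<le> g x"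
    and g_0: "g 0 = 0"
begin

lemma g_nonneg: "0 \<le> g x"
  using g_min[of x] g_0 by simp

lemma g_strict: "x \<noteq> y \<Longrightarrow> 0 < t \<Longrightarrow> t < 1 \<Longrightarrow> g ((1 - t) * x + t * y) < (1 - t) * g x + t * g y"
  using g_convex unfolding strictly_convex_def by blast

lemma continuous_on_g: "continuous_on UNIV g"
proof -
  have "convex_on UNIV g"
  proof (rule convex_onI)
    fix t x y :: real
    assume t: "0 < t" "t < 1"
    show "g ((1 - t) *\<^sub>R x + t *\<^sub>R y) \<le> (1 - t) * g x + t * g y"
    proof (cases "x = y")
      case True
      then show ?thesis by (simp add: algebra_simps flip: distrib_right)
    next
      case False
      then show ?thesis using g_strict[OF False t] by simp
    qed
  qed simp
  then show ?thesis by (intro convex_on_continuous) auto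
qed

lemma measurable_g [measurable]: "g \<in> borel_measurable borel"
  using continuous_on_g by (rule borel_measurable_continuous_onI)

text \<open>
  Along the segment from 0, where \<open>g\<close> vanishes, to a point \<open>x\<close> beyond \<open>1\<close> or \<open>-1\<close>, convexity makes
  \<open>g x\<close> at least the value at \<open>1\<close> or \<open>-1\<close> times the absolute value of \<open>x\<close>.
\<close>
lemma linear_lower_bound: "\<exists>c>0. \<forall>x. c * (\<bar>x\<bar> - 1) \<le> g x"
proof (rule exI[of _ "min (g 1) (g (-1))"], intro conjI allI)
  have "0 < g x" if "x \<noteq> 0" for x
    using g_strict[of x 0 "1/2"] g_nonneg[of "x / 2"] that by (simp add: g_0)
  then show "0 < min (g 1) (g (-1))" by simp
  fix x :: real
  show "min (g 1) (g (-1)) * (\<bar>x\<bar> - 1) \<le> g x"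
  proof (cases "\<bar>x\<bar> \<le> 1")
    case True
    then have "min (g 1) (g (-1)) * (\<bar>x\<bar> - 1) \<le> 0"
      using g_nonneg by (intro mult_nonneg_nonpos) auto
    then show ?thesis using g_nonneg[of x] by linarith
  next
    case False
    then have "1 / \<bar>x\<bar> * x = sgn x"
      using False by (cases x "0 :: real" rule: linorder_cases) auto
    moreover have "g ((1 - 1 / \<bar>x\<bar>) * 0 + 1 / \<bar>x\<bar> * x) < (1 - 1 / \<bar>x\<bar>) * g 0 + 1 / \<bar>x\<bar> * g x"
      using False by (intro g_strict) auto
    ultimately have "g (sgn x) < g x / \<bar>x\<bar>" by (simp add: g_0)
    then have "g (sgn x) * \<bar>x\<bar> < g x" using False by (simp add: field_simps)
    moreover have "min (g 1) (g (-1)) * (\<bar>x\<bar> - 1) \<le> g (sgn x) * \<bar>x\<bar>"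
      using False g_nonneg by (intro mult_mono) (auto simp: sgn_if)
    ultimately show ?thesis by linarith
  qed
qed

end

text \<open>
  The total mass is not fixed to 1, so that the counting measure on sample indices is an
  instance.
\<close>
locale finite_expected_loss = convex_loss g + finite_measure N
  for g :: "real \<Rightarrow> real" and N :: "'a measure" +
  fixes Y :: "'a \<Rightarrow> real"
  assumes Y_measurable [measurable]: "Y \<in> borel_measurable N"
    and N_nonzero: "emeasure N (space N) \<noteq> 0"
    and finite_somewhere: "\<exists>x. expected_loss g N Y x < \<infinity>"
begin

abbreviation \<xi> :: "real \<Rightarrow> ennreal" where "\<xi> \<equiv> expected_loss g N Y"

lemma finite_imp_integrable:
  assumes "\<xi> x < \<infinity>"
  shows "integrable N (\<lambda>\<omega>. g (Y \<omega> - x))" and "\<xi> x = ennreal (\<integral>\<omega>. g (Y \<omega> - x) \<partial>N)"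
    and "(\<integral>\<omega>. g (Y \<omega> - x) \<partial>N) = enn2real (\<xi> x)"
proof -
  show "integrable N (\<lambda>\<omega>. g (Y \<omega> - x))"
    using assms g_nonneg by (intro integrableI_nonneg) (auto simp: expected_loss_def)
  then show "\<xi> x = ennreal (\<integral>\<omega>. g (Y \<omega> - x) \<partial>N)"
    unfolding expected_loss_def using g_nonneg by (intro nn_integral_eq_integral) auto
  then show "(\<integral>\<omega>. g (Y \<omega> - x) \<partial>N) = enn2real (\<xi> x)"
    using g_nonneg by (simp add: integral_nonneg_AE)
qed

text \<open>
  Where the expected loss is finite it inherits strict convexity by integration, because a
  strict pointwise inequality stays strict over a nonzero measure. Only the consequence for
  sublevel sets is recorded: it yields both the uniqueness of the minimizer and its localization.
\<close>
lemma expected_loss_strictly_quasiconvex: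
  assumes "\<xi> a \<le> m" "\<xi> b \<le> m" "m < \<infinity>" "a \<noteq> b" "0 < t" "t < 1"
  shows "\<xi> ((1 - t) * a + t * b) < m"
proof -
  let ?c = "(1 - t) * a + t * b"
  have fin: "\<xi> a < \<infinity>" "\<xi> b < \<infinity>" using assms by (auto intro: le_less_trans)
  note a = finite_imp_integrable[OF fin(1)] and b = finite_imp_integrable[OF fin(2)]
  have strict: "g (Y \<omega> - ?c) < (1 - t) * g (Y \<omega> - a) + t * g (Y \<omega> - b)" for \<omega>
    using g_strict[of "Y \<omega> - a" "Y \<omega> - b" t] assms by (simp add: algebra_simps)
  have ab: "integrable N (\<lambda>\<omega>. (1 - t) * g (Y \<omega> - a) + t * g (Y \<omega> - b))"
    using a(1) b(1) by simp
  have c: "integrable N (\<lambda>\<omega>. g (Y \<omega> - ?c))"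
    by (rule Bochner_Integration.integrable_bound[OF ab])
       (use strict g_nonneg assms in \<open>auto intro!: AE_I2 less_imp_le simp: less_imp_le abs_of_nonneg\<close>)
  have m: "m = ennreal (enn2real m)" using assms by simp
  have le: "(\<integral>\<omega>. g (Y \<omega> - a) \<partial>N) \<le> enn2real m" "(\<integral>\<omega>. g (Y \<omega> - b) \<partial>N) \<le> enn2real m"
    using assms(1-3) unfolding a(3) b(3) by (auto intro: enn2real_mono)
  have "(\<integral>\<omega>. g (Y \<omega> - ?c) \<partial>N) < (\<integral>\<omega>. (1 - t) * g (Y \<omega> - a) + t * g (Y \<omega> - b) \<partial>N)"
    using strict N_nonzero by (intro integral_less_AE_space c ab) auto
  also have "\<dots> = (1 - t) * (\<integral>\<omega>. g (Y \<omega> - a) \<partial>N) + t * (\<integral>\<omega>. g (Y \<omega> - b) \<partial>N)"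
    using a(1) b(1) by simp
  also have "\<dots> \<le> (1 - t) * enn2real m + t * enn2real m"
    using le assms by (intro add_mono mult_left_mono) auto
  also have "\<dots> = enn2real m" by (simp add: algebra_simps)
  finally have "ennreal (\<integral>\<omega>. g (Y \<omega> - ?c) \<partial>N) < ennreal (enn2real m)"
    using g_nonneg by (subst ennreal_less_iff) (auto intro: integral_nonneg_AE)
  moreover have "\<xi> ?c = ennreal (\<integral>\<omega>. g (Y \<omega> - ?c) \<partial>N)"
    unfolding expected_loss_def using g_nonneg c by (intro nn_integral_eq_integral) auto
  ultimately show ?thesis using m by simp
qed

text \<open>
  If \<open>x\<close> and \<open>x0\<close> are far apart, every value of \<open>Y\<close> is far from one of them. By the linear lower
  bound, \<open>g (Y - x) + g (Y - x0)\<close> then exceeds a multiple of their distance, uniformly in \<open>Y\<close>,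
  and therefore so does its integral.
\<close>
lemma bounded_sublevel_set:
  assumes "m < \<infinity>"
  shows "bounded {x. \<xi> x \<le> m}"
proof (cases "\<exists>x0. \<xi> x0 \<le> m")
  case True
  then obtain x0 where x0: "\<xi> x0 \<le> m" ..
  obtain c where c: "c > 0" "\<And>x. c * (\<bar>x\<bar> - 1) \<le> g x"
    using linear_lower_bound by blast
  have pos: "0 < measure N (space N)" 
    using N_nonzero by (simp add: emeasure_eq_measure zero_less_measure_iff)
  have fin: "\<xi> x < \<infinity>" if "\<xi> x \<le> m" for x using assms that by (rule le_less_trans[rotated])
  have "\<bar>x - x0\<bar> \<le> (2 * enn2real m / measure N (space N) + 2 * c) / c" if x: "\<xi> x \<le> m" for x
  proof -
    note ix = finite_imp_integrable[OF fin[OF x]] and i0 = finite_imp_integrable[OF fin[OF x0]]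
    have le: "(\<integral>\<omega>. g (Y \<omega> - x) \<partial>N) \<le> enn2real m" "(\<integral>\<omega>. g (Y \<omega> - x0) \<partial>N) \<le> enn2real m"
      using x x0 assms unfolding ix(3) i0(3) by (auto intro: enn2real_mono)
    have "c * \<bar>x - x0\<bar> - 2 * c \<le> g (Y \<omega> - x) + g (Y \<omega> - x0)" for \<omega>
    proof -
      have "c * \<bar>x - x0\<bar> \<le> c * (\<bar>Y \<omega> - x\<bar> + \<bar>Y \<omega> - x0\<bar>)"
        using c(1) by (intro mult_left_mono) auto
      then show ?thesis using c(2)[of "Y \<omega> - x"] c(2)[of "Y \<omega> - x0"] by (simp add: algebra_simps)
    qed
    then have "(\<integral>\<omega>. c * \<bar>x - x0\<bar> - 2 * c \<partial>N) \<le> (\<integral>\<omega>. g (Y \<omega> - x) + g (Y \<omega> - x0) \<partial>N)"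
      using ix(1) i0(1) by (intro integral_mono) auto
    also have "\<dots> \<le> 2 * enn2real m" using ix(1) i0(1) le by simp
    finally have "(c * \<bar>x - x0\<bar> - 2 * c) * measure N (space N) \<le> 2 * enn2real m"
      by (simp add: mult.commute)
    then show ?thesis using c(1) pos by (simp add: field_simps)
  qed
  then show ?thesis by (auto simp: bounded_def dist_real_def abs_minus_commute intro!: exI)
next
  case False
  then show ?thesis by simp
qed

text \<open>
  Lower semicontinuity is the most one can expect, since the expected loss may jump to
  infinity; it is Fatou's lemma.
\<close>
lemma expected_loss_le_liminf:
  assumes "x \<longlonglongrightarrow> l"
  shows "\<xi> l \<le> liminf (\<lambda>n. \<xi> (x n))"
proof -
  have "(\<lambda>n. ennreal (g (Y \<omega> - x n))) \<longlonglongrightarrow> ennreal (g (Y \<omega> - l))" for \<omega>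
    using continuous_on_g assms
    by (intro tendsto_ennrealI isCont_tendsto_compose[of _ g] tendsto_diff tendsto_const)
       (auto simp: continuous_on_eq_continuous_at)
  then have "ennreal (g (Y \<omega> - l)) = liminf (\<lambda>n. ennreal (g (Y \<omega> - x n)))" for \<omega>
    by (intro lim_imp_Liminf[symmetric]) auto
  then show ?thesis
    unfolding expected_loss_def by (simp add: nn_integral_liminf)
qed

lemma ex_minimizer: "\<exists>l. \<forall>y. \<xi> l \<le> \<xi> y"
proof -
  obtain x0 where x0: "\<xi> x0 < \<infinity>" using finite_somewhere by blast
  obtain v where v: "range v \<subseteq> range \<xi>" "decseq v" "(INF y. \<xi> y) = (INF n. v n)"
    using ennreal_Inf_countable_INF[of "range \<xi>"] by auto
  \<comment> \<open>the second bound keeps the minimizing sequence in one bounded sublevel set\<close>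
  have "\<exists>x. \<xi> x \<le> v n \<and> \<xi> x \<le> \<xi> x0" for n
  proof -
    obtain x where "v n = \<xi> x" using v(1) by blast
    then show ?thesis by (metis linear order_refl)
  qed
  then obtain x where x: "\<And>n. \<xi> (x n) \<le> v n" "\<And>n. \<xi> (x n) \<le> \<xi> x0" by metis
  have "bounded (range x)"
    by (rule bounded_subset[OF bounded_sublevel_set[OF x0]]) (use x(2) in auto)
  then obtain l r where r: "strict_mono r" "(x \<circ> r) \<longlonglongrightarrow> l"
    using bounded_imp_convergent_subsequence by blast
  have "\<xi> l \<le> v n" for n
  proof -
    have "\<xi> l \<le> liminf (\<lambda>k. \<xi> ((x \<circ> r) k))" by (rule expected_loss_le_liminf[OF r(2)])
    also have "\<dots> \<le> v n"
    proof (rule Liminf_le)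
      show "eventually (\<lambda>k. \<xi> ((x \<circ> r) k) \<le> v n) sequentially"
        using eventually_ge_at_top[of n]
      proof eventually_elim
        case (elim k)
        then have "v (r k) \<le> v n"
          using v(2) seq_suble[OF r(1), of k] by (auto simp: decseq_def)
        then show ?case using x(1)[of "r k"] by simp
      qed
    qed simp
    finally show ?thesis .
  qed
  then have "\<xi> l \<le> (INF y. \<xi> y)" unfolding v(3) by (intro INF_greatest)
  then show ?thesis by (meson INF_lower UNIV_I order_trans)
qed

lemma ex1_minimizer: "\<exists>!z. is_arg_min \<xi> (\<lambda>_. True) z"
proof -
  obtain x0 where x0: "\<xi> x0 < \<infinity>" using finite_somewhere by blast
  obtain z where z: "\<And>y. \<xi> z \<le> \<xi> y" using ex_minimizer by blast
  show ?thesis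
  proof (rule ex1I[of _ z])
    show "is_arg_min \<xi> (\<lambda>_. True) z" using z by (simp add: is_arg_min_linorder)
    fix w assume "is_arg_min \<xi> (\<lambda>_. True) w"
    then have w: "\<And>y. \<xi> w \<le> \<xi> y" by (simp add: is_arg_min_linorder)
    show "w = z"
    proof (rule ccontr)
      assume "w \<noteq> z"
      then have "\<xi> ((1 - 1/2) * w + 1/2 * z) < \<xi> z"
        using w[of z] x0 z[of x0] by (intro expected_loss_strictly_quasiconvex) auto
      then show False using z not_le by blast
    qed
  qed
qed

lemma argmin_le: "\<xi> (argmin \<xi>) \<le> \<xi> y"
proof -
  have "is_arg_min \<xi> (\<lambda>_. True) (argmin \<xi>)"
    unfolding argmin_def by (rule theI'[OF ex1_minimizer])
  then show ?thesis by (simp add: is_arg_min_linorder)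
qed

lemma argmin_less: "y \<noteq> argmin \<xi> \<Longrightarrow> \<xi> (argmin \<xi>) < \<xi> y"
  using ex1_minimizer argmin_le unfolding is_arg_min_linorder
  by (metis order_less_le order_trans)

text \<open>
  If the minimizer lay at distance at least \<open>e\<close>, then \<open>c + e\<close> or \<open>c - e\<close> would lie on the segment
  from \<open>c\<close> to it, where convexity bounds the loss by its value at \<open>c\<close>.
\<close>
lemma argmin_localized:
  assumes "\<xi> c < \<xi> (c + e)" "\<xi> c < \<xi> (c - e)" "0 < e"
  shows "\<bar>argmin \<xi> - c\<bar> < e"
proof (rule ccontr)
  assume far: "\<not> \<bar>argmin \<xi> - c\<bar> < e"
  define z where "z = argmin \<xi>"
  define t where "t = e / \<bar>z - c\<bar>"
  have z: "\<xi> z \<le> \<xi> y" for y using argmin_le by (simp add: z_def)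
  have far': "e \<le> \<bar>z - c\<bar>" using far by (simp add: z_def)
  have t: "0 < t" "t \<le> 1" using assms(3) far' by (auto simp: t_def)
  define p where "p = (1 - t) * c + t * z"
  have "p = c + t * (z - c)" by (simp add: p_def algebra_simps)
  moreover have "t * (z - c) = e \<or> t * (z - c) = - e"
  proof -
    have "\<bar>t * (z - c)\<bar> = t * \<bar>z - c\<bar>" by (simp only: abs_mult abs_of_pos[OF t(1)])
    also have "\<dots> = e" using assms(3) far' by (simp add: t_def)
    finally show ?thesis by linarith
  qed
  ultimately have p: "p = c + e \<or> p = c - e" by linarith
  have "\<xi> p \<le> \<xi> c"
  proof (cases "t = 1")
    case False
    have "\<xi> c < \<infinity>" using order.strict_trans2[OF assms(1) top_greatest] by simp
    then show ?thesis
      using z[of c] t False assms(3) far'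
      unfolding p_def by (intro expected_loss_strictly_quasiconvex[THEN less_imp_le]) auto
  qed (use z[of c] in \<open>simp add: p_def\<close>)
  then show False using p assms(1,2) not_le by blast
qed

end

text \<open>
  Write \<open>c\<close> for the minimizer of the expected loss. By uniqueness, the expected loss at
  \<open>c + e\<close> and at \<open>c - e\<close> is strictly larger than at \<open>c\<close>, possibly infinite. If almost surely the
  empirical loss eventually shows the same two inequalities, then convexity confines the
  empirical minimizer to the interval between \<open>c - e\<close> and \<open>c + e\<close>. Taking \<open>e\<close> through a
  sequence that tends to 0 gives the convergence.

  The empirical comparison of \<open>c\<close> with \<open>c + e\<close> only asks for the sign of a sum of i.i.d. terms
  \<open>g (X i - c) - g (X i - (c + e))\<close> whose mean is negative. The second part may have infinite
  mean; cutting it off at a high level keeps the mean of the difference negative and makes it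
  integrable (\<open>larger_mean_eventually_larger_sum\<close>). What remains is the one-sided strong law:
  an integrable random walk with negative drift is eventually negative. This follows once a walk
  with negative drift is known to be bounded above (\<open>negative_drift_bounded\<close>), since the walk
  stays bounded after adding a small constant to each step. That boundedness is proved on the
  sequence space by the argument of the maximal ergodic theorem.

  Existence and uniqueness of minimizers are proved for the expected loss over an
  arbitrary nonzero finite measure (\<open>ex1_minimizer\<close>). With a counting measure on the sample
  indices, the same lemmas apply to the empirical loss.
\<close>

section \<open>Random walks with negative drift\<close>

text \<open>
  This is the maximum of the partial sums \<open>f (z 0) + \<dots> + f (z (k - 1))\<close> over \<open>k \<le> n\<close>. The
  recursion splits off the first step rather than the last one, because the proof compares the
  walk with the walk that starts one step later.
\<close>
primrec running_max :: "('a \<Rightarrow> real) \<Rightarrow> nat \<Rightarrow> (nat \<Rightarrow> 'a) \<Rightarrow> real" where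
  "running_max f 0 z = 0"
| "running_max f (Suc n) z = max 0 (f (z 0) + running_max f n (\<lambda>i. z (Suc i)))"

lemma running_max_nonneg: "0 \<le> running_max f n z"
  by (cases n) auto

lemma running_max_Suc_mono: "running_max f n z \<le> running_max f (Suc n) z"
proof (induction n arbitrary: z)
  case (Suc n)
  show ?case using Suc[of "\<lambda>i. z (Suc i)"] by (simp add: max_def)
qed simp

lemma running_max_mono: "m \<le> n \<Longrightarrow> running_max f m z \<le> running_max f n z"
  using lift_Suc_mono_le[of "\<lambda>n. running_max f n z"] running_max_Suc_mono by metis

lemma partial_sum_le_running_max: "(\<Sum>i<n. f (z i)) \<le> running_max f n z"
proof (induction n arbitrary: z)
  case (Suc n)
  have "(\<Sum>i<Suc n. f (z i)) = f (z 0) + (\<Sum>i<n. f (z (Suc i)))"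
    by (rule sum.lessThan_Suc_shift)
  also have "\<dots> \<le> f (z 0) + running_max f n (\<lambda>i. z (Suc i))"
    using Suc[of "\<lambda>i. z (Suc i)"] by simp
  finally show ?case by simp
qed simp

definition unbounded_walk :: "('a \<Rightarrow> real) \<Rightarrow> (nat \<Rightarrow> 'a) \<Rightarrow> bool" where
  "unbounded_walk f z \<longleftrightarrow> (\<forall>k::nat. \<exists>n. real k < running_max f n z)"

lemma unbounded_walk_iff: "unbounded_walk f z \<longleftrightarrow> (\<forall>c. \<exists>n. c < running_max f n z)"
  unfolding unbounded_walk_def by (meson reals_Archimedean2 less_trans)

text \<open>
  A first step changes the running maximum by a bounded amount only. Hence unboundedness is an
  event about the remaining steps, independent of the first one.
\<close>
lemma unbounded_walk_case_nat: "unbounded_walk f (case_nat s z) \<longleftrightarrow> unbounded_walk f z"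
proof
  assume *: "unbounded_walk f (case_nat s z)"
  show "unbounded_walk f z" unfolding unbounded_walk_iff
  proof
    fix c
    obtain n where n: "max 0 (f s + c) < running_max f n (case_nat s z)"
      using * unfolding unbounded_walk_iff by blast
    then obtain m where "n = Suc m" by (cases n) auto
    with n have "c < running_max f m z" by (auto simp: max_def split: if_splits)
    then show "\<exists>n. c < running_max f n z" ..
  qed
next
  assume *: "unbounded_walk f z"
  show "unbounded_walk f (case_nat s z)" unfolding unbounded_walk_iff
  proof
    fix c
    obtain n where n: "c - f s < running_max f n z"
      using * unfolding unbounded_walk_iff by blast
    then have "c < running_max f (Suc n) (case_nat s z)" by auto
    then show "\<exists>n. c < running_max f n (case_nat s z)" ..
  qed
qed

context sequence_space
begin

lemma measurable_running_max [measurable]: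
  assumes [measurable]: "f \<in> borel_measurable M"
  shows "running_max f n \<in> borel_measurable S"
proof (induction n)
  case (Suc n)
  note Suc [measurable]
  have [measurable]: "(\<lambda>z i. z (Suc i)) \<in> S \<rightarrow>\<^sub>M S"
    by (rule measurable_PiM_single') (auto simp: space_PiM)
  show ?case by simp
qed simp

lemma integrable_product_fst:
  fixes f :: "'a \<Rightarrow> real"
  assumes "integrable M f"
  shows "integrable (M \<Otimes>\<^sub>M S) (\<lambda>p. f (fst p))"
proof -
  have d: "distr (M \<Otimes>\<^sub>M S) M fst = M" by (rule P.distr_pair_fst)
  have [measurable]: "f \<in> borel_measurable M" using assms by auto
  show ?thesis
    using assms by (subst (asm) d[symmetric]) (simp add: integrable_distr_eq)
qed

lemma distr_product_snd: "distr (M \<Otimes>\<^sub>M S) S snd = S"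
proof (intro measure_eqI)
  fix A assume "A \<in> sets (distr (M \<Otimes>\<^sub>M S) S snd)"
  then have A: "A \<in> sets S" by simp
  have "snd -` A \<inter> space (M \<Otimes>\<^sub>M S) = space M \<times> A"
    using sets.sets_into_space[OF A] by (auto simp: space_pair_measure)
  then show "emeasure (distr (M \<Otimes>\<^sub>M S) S snd) A = emeasure S A"
    using A by (simp add: emeasure_distr P.emeasure_pair_measure_Times M.emeasure_space_1)
qed simp

text \<open>
  An i.i.d. sequence can be generated by drawing its head and, independently, its tail.
\<close>
lemma integral_sequence_space:
  fixes h :: "(nat \<Rightarrow> 'a) \<Rightarrow> real"
  assumes [measurable]: "h \<in> borel_measurable S"
  shows "integrable S h \<longleftrightarrow> integrable (M \<Otimes>\<^sub>M S) (\<lambda>p. h (case_nat (fst p) (snd p)))"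
    and "(\<integral>z. h z \<partial>S) = (\<integral>p. h (case_nat (fst p) (snd p)) \<partial>(M \<Otimes>\<^sub>M S))"
proof -
  have d: "distr (M \<Otimes>\<^sub>M S) S (\<lambda>p. case_nat (fst p) (snd p)) = S"
    using PiM_iter by (simp add: split_beta')
  have [measurable]: "(\<lambda>p. case_nat (fst p) (snd p)) \<in> (M \<Otimes>\<^sub>M S) \<rightarrow>\<^sub>M S"
    by measurable
  show "integrable S h \<longleftrightarrow> integrable (M \<Otimes>\<^sub>M S) (\<lambda>p. h (case_nat (fst p) (snd p)))"
    by (subst d[symmetric]) (simp add: integrable_distr_eq)
  show "(\<integral>z. h z \<partial>S) = (\<integral>p. h (case_nat (fst p) (snd p)) \<partial>(M \<Otimes>\<^sub>M S))"
    by (subst (1) d[symmetric]) (simp add: integral_distr)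
qed

lemma integrable_running_max:
  assumes f: "integrable M f"
  shows "integrable S (running_max f n)"
proof (induction n)
  case (Suc n)
  have [measurable]: "f \<in> borel_measurable M" using f by auto
  have "integrable (M \<Otimes>\<^sub>M S) (\<lambda>p. running_max f n (snd p))"
    using Suc by (subst (asm) distr_product_snd[symmetric]) (simp add: integrable_distr_eq)
  then have "integrable (M \<Otimes>\<^sub>M S) (\<lambda>p. max 0 (f (fst p) + running_max f n (snd p)))"
    using integrable_product_fst[OF f] by (intro integrable_max Bochner_Integration.integrable_add) auto
  moreover have "running_max f (Suc n) \<in> borel_measurable S" by measurable
  ultimately show ?case by (subst integral_sequence_space(1)) simp_all
qed simp

text \<open>
  Let \<open>R n\<close> be the running maximum, \<open>A\<close> the event that it is unbounded, and \<open>(s, z)\<close> the head and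
  the tail of a sequence. Since \<open>R (n + 1)\<close> dominates \<open>R n\<close>, the integral of
  \<open>R (n + 1) - R n\<close> over \<open>A\<close> is nonnegative. The law of the tail is that of the whole sequence and
  \<open>A\<close> is determined by the tail, so this integral equals that of
  \<open>R (n + 1) (s, z) - R n z = max (f s) (- R n z)\<close> over \<open>z \<in> A\<close>. On \<open>A\<close> this tends to \<open>f s\<close>, and it is
  dominated by the absolute value of \<open>f s\<close>. In the limit, the mean of \<open>f\<close> times the probability of
  \<open>A\<close> is nonnegative, which forces \<open>A\<close> to be null.
\<close>
lemma negative_drift_bounded:
  fixes f :: "'a \<Rightarrow> real"
  assumes f: "integrable M f" and neg: "(\<integral>x. f x \<partial>M) < 0"
  shows "AE z in S. \<not> unbounded_walk f z"
proof -
  interpret MS: pair_sigma_finite M S ..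
  let ?R = "running_max f"
  have [measurable]: "f \<in> borel_measurable M" using f by auto
  define u :: "(nat \<Rightarrow> 'a) \<Rightarrow> real" where "u z = of_bool (unbounded_walk f z)" for z
  have u_meas [measurable]: "u \<in> borel_measurable S"
    unfolding u_def unbounded_walk_def by measurable
  have u_shift: "u (case_nat s z) = u z" for s z by (simp add: u_def unbounded_walk_case_nat)
  have uR: "integrable S (\<lambda>z. u z * ?R n z)" for n
  proof (rule Bochner_Integration.integrable_bound[OF integrable_running_max[OF f, of n]])
    show "(\<lambda>z. u z * ?R n z) \<in> borel_measurable S" by measurable
  qed (auto simp: u_def)
  have uR_snd: "integrable (M \<Otimes>\<^sub>M S) (\<lambda>p. u (snd p) * ?R n (snd p))"
      "(\<integral>p. u (snd p) * ?R n (snd p) \<partial>(M \<Otimes>\<^sub>M S)) = (\<integral>z. u z * ?R n z \<partial>S)" for n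
    using uR[of n] by (subst (asm) (1) distr_product_snd[symmetric], simp add: integrable_distr_eq)
      (subst (2) distr_product_snd[symmetric], simp add: integral_distr)
  have uR_Suc: "integrable (M \<Otimes>\<^sub>M S) (\<lambda>p. u (snd p) * ?R (Suc n) (case_nat (fst p) (snd p)))"
      "(\<integral>z. u z * ?R (Suc n) z \<partial>S) =
        (\<integral>p. u (snd p) * ?R (Suc n) (case_nat (fst p) (snd p)) \<partial>(M \<Otimes>\<^sub>M S))" for n
    using uR[of "Suc n"] integral_sequence_space[of "\<lambda>z. u z * ?R (Suc n) z"] 
    by (simp_all add: u_shift del: running_max.simps)
  \<comment> \<open>what prepending the head adds to the running maximum, on the event of an unbounded walk\<close>
  define D where "D n p = u (snd p) * max (f (fst p)) (- ?R n (snd p))" for n p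
  have D_meas [measurable]: "D n \<in> borel_measurable (M \<Otimes>\<^sub>M S)" for n
    unfolding D_def by measurable
  have D_nonneg: "0 \<le> (\<integral>p. D n p \<partial>(M \<Otimes>\<^sub>M S))" for n
  proof -
    have "D n = (\<lambda>p. u (snd p) * ?R (Suc n) (case_nat (fst p) (snd p)) - u (snd p) * ?R n (snd p))"
      by (auto simp: D_def fun_eq_iff algebra_simps max_def u_def)
    then have "(\<integral>p. D n p \<partial>(M \<Otimes>\<^sub>M S)) = (\<integral>z. u z * ?R (Suc n) z \<partial>S) - (\<integral>z. u z * ?R n z \<partial>S)"
      using uR_snd[of n] uR_Suc[of n] by (simp del: running_max.simps)
    moreover have "(\<integral>z. u z * ?R n z \<partial>S) \<le> (\<integral>z. u z * ?R (Suc n) z \<partial>S)"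
      using running_max_Suc_mono[of f n] 
      by (intro integral_mono uR) (auto simp: u_def simp del: running_max.simps)
    ultimately show ?thesis by simp
  qed
  have D_lim: "(\<lambda>n. \<integral>p. D n p \<partial>(M \<Otimes>\<^sub>M S)) \<longlonglongrightarrow> (\<integral>p. u (snd p) * f (fst p) \<partial>(M \<Otimes>\<^sub>M S))"
  proof (rule integral_dominated_convergence)
    show "integrable (M \<Otimes>\<^sub>M S) (\<lambda>p. \<bar>f (fst p)\<bar>)"
      using integrable_product_fst[OF f] by simp
    show "AE p in M \<Otimes>\<^sub>M S. norm (D n p) \<le> \<bar>f (fst p)\<bar>" for n
    proof (rule AE_I2)
      fix p :: "'a \<times> (nat \<Rightarrow> 'a)"
      show "norm (D n p) \<le> \<bar>f (fst p)\<bar>"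
        using running_max_nonneg[of f n "snd p"] by (auto simp: D_def u_def)
    qed
    show "AE p in M \<Otimes>\<^sub>M S. (\<lambda>n. D n p) \<longlonglongrightarrow> u (snd p) * f (fst p)"
    proof (rule AE_I2)
      fix p :: "'a \<times> (nat \<Rightarrow> 'a)"
      show "(\<lambda>n. D n p) \<longlonglongrightarrow> u (snd p) * f (fst p)"
      proof (cases "unbounded_walk f (snd p)")
        case True
        then obtain m where m: "- f (fst p) < ?R m (snd p)"
          unfolding unbounded_walk_iff by blast
        have "eventually (\<lambda>n. D n p = u (snd p) * f (fst p)) sequentially"
          using eventually_ge_at_top[of m]
        proof eventually_elim
          case (elim n)
          show ?case using m running_max_mono[OF elim, of f "snd p"] by (simp add: D_def max_def)
        qed
        then show ?thesis by (rule tendsto_eventually)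
      qed (simp add: D_def u_def)
    qed
  qed (use D_meas in measurable)
  have fu: "integrable (M \<Otimes>\<^sub>M S) (\<lambda>p. u (snd p) * f (fst p))"
  proof (rule Bochner_Integration.integrable_bound[OF integrable_product_fst[OF f]])
    show "(\<lambda>p. u (snd p) * f (fst p)) \<in> borel_measurable (M \<Otimes>\<^sub>M S)" by measurable
  qed (auto simp: u_def)
  then have "(\<integral>p. u (snd p) * f (fst p) \<partial>(M \<Otimes>\<^sub>M S)) = (\<integral>z. \<integral>x. u z * f x \<partial>M \<partial>S)"
    using MS.integral_snd[of "\<lambda>x z. u z * f x"] by (simp add: split_beta')
  also have "\<dots> = (\<integral>z. u z \<partial>S) * (\<integral>x. f x \<partial>M)"
    by simp
  finally have "0 \<le> (\<integral>z. u z \<partial>S) * (\<integral>x. f x \<partial>M)"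
    using LIMSEQ_le_const[OF D_lim] D_nonneg by auto
  then have "(\<integral>z. u z \<partial>S) \<le> 0" using neg by (simp add: zero_le_mult_iff)
  moreover have "integrable S u"
    by (rule P.integrable_const_bound[of _ 1]) (auto simp: u_def)
  moreover have "AE z in S. 0 \<le> u z" by (auto simp: u_def)
  ultimately have "AE z in S. u z = 0"
    by (metis integral_nonneg_eq_0_iff_AE integral_nonneg_AE order_antisym)
  then show ?thesis by eventually_elim (auto simp: u_def)
qed

text \<open>
  Half of the drift suffices to keep the walk bounded; the other half then drives it to
  minus infinity.
\<close>
lemma negative_drift_eventually_negative:
  fixes f :: "'a \<Rightarrow> real"
  assumes f: "integrable M f" and neg: "(\<integral>x. f x \<partial>M) < 0"
  shows "AE z in S. eventually (\<lambda>n. (\<Sum>i<n. f (z i)) < 0) sequentially"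
proof -
  define d where "d = - (\<integral>x. f x \<partial>M) / 2"
  have d: "d > 0" using neg by (simp add: d_def)
  have "integrable M (\<lambda>x. f x + d)" using f by simp
  moreover have "(\<integral>x. f x + d \<partial>M) < 0"
    using f d by (simp add: M.prob_space d_def)
  ultimately have "AE z in S. \<not> unbounded_walk (\<lambda>x. f x + d) z"
    by (rule negative_drift_bounded)
  then show ?thesis
  proof eventually_elim
    case (elim z)
    then obtain c where c: "\<And>n. running_max (\<lambda>x. f x + d) n z \<le> c"
      unfolding unbounded_walk_iff by (auto simp: not_less)
    obtain m :: nat where m: "c < m * d" using d reals_Archimedean3 by blast
    show ?case using eventually_ge_at_top[of m]
    proof eventually_elim
      case (elim n)
      have "(\<Sum>i<n. f (z i)) + n * d = (\<Sum>i<n. f (z i) + d)" by (simp add: sum.distrib)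
      also have "\<dots> \<le> c" using partial_sum_le_running_max[of "\<lambda>x. f x + d"] c by (rule order_trans)
      also have "c < m * d" by (rule m)
      also have "\<dots> \<le> n * d" using elim d by (simp add: mult_right_mono)
      finally show ?case by simp
    qed
  qed
qed

text \<open>
  If \<open>V\<close> has infinite mean, the difference \<open>U - V\<close> is not integrable, so \<open>V\<close> is first replaced by
  \<open>min V k\<close>. By monotone convergence the strict inequality between the means survives for
  large \<open>k\<close>.
\<close>
lemma larger_mean_eventually_larger_sum:
  fixes U V :: "'a \<Rightarrow> real"
  assumes [measurable]: "U \<in> borel_measurable M" "V \<in> borel_measurable M"
    and nonneg: "\<And>x. 0 \<le> U x" "\<And>x. 0 \<le> V x"
    and less: "(\<integral>\<^sup>+x. ennreal (U x) \<partial>M) < (\<integral>\<^sup>+x. ennreal (V x) \<partial>M)"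
  shows "AE z in S. eventually (\<lambda>n. (\<Sum>i<n. U (z i)) < (\<Sum>i<n. V (z i))) sequentially"
proof -
  define W :: "nat \<Rightarrow> 'a \<Rightarrow> real" where "W k x = min (V x) (real k)" for k x
  have [measurable]: "W k \<in> borel_measurable M" for k unfolding W_def by measurable
  have "(SUP k. ennreal (W k x)) = ennreal (V x)" for x
  proof (rule antisym)
    show "(SUP k. ennreal (W k x)) \<le> ennreal (V x)"
      by (intro SUP_least ennreal_leI) (simp add: W_def)
    obtain k :: nat where "V x \<le> k" using real_arch_simple by blast
    then have "W k x = V x" by (simp add: W_def)
    then show "ennreal (V x) \<le> (SUP k. ennreal (W k x))"
      by (metis SUP_upper UNIV_I)
  qed
  then have "(\<integral>\<^sup>+x. ennreal (V x) \<partial>M) = (\<integral>\<^sup>+x. (SUP k. ennreal (W k x)) \<partial>M)" by simp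
  also have "\<dots> = (SUP k. \<integral>\<^sup>+x. ennreal (W k x) \<partial>M)"
    by (rule nn_integral_monotone_convergence_SUP)
       (auto simp: incseq_def le_fun_def W_def intro!: ennreal_leI)
  finally obtain k where k: "(\<integral>\<^sup>+x. ennreal (U x) \<partial>M) < (\<integral>\<^sup>+x. ennreal (W k x) \<partial>M)"
    using less by (auto simp: less_SUP_iff)
  have W_nonneg: "0 \<le> W k x" for x using nonneg by (simp add: W_def)
  have W: "integrable M (W k)"
    using nonneg by (intro M.integrable_const_bound[of _ "real k"]) (auto simp: W_def)
  have U: "integrable M U"
    using nonneg order.strict_trans2[OF less top_greatest] by (intro integrableI_nonneg) auto
  have "ennreal (\<integral>x. U x \<partial>M) < ennreal (\<integral>x. W k x \<partial>M)"
    using k nonneg nn_integral_eq_integral[OF U] nn_integral_eq_integral[OF W] W_nonneg by simp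
  then have "(\<integral>x. U x - W k x \<partial>M) < 0"
    using U W nonneg by (simp add: ennreal_less_iff integral_nonneg_AE)
  with U W have "AE z in S. eventually (\<lambda>n. (\<Sum>i<n. U (z i) - W k (z i)) < 0) sequentially"
    by (intro negative_drift_eventually_negative) auto
  then show ?thesis
  proof eventually_elim
    case (elim z)
    then show ?case
    proof eventually_elim
      case (elim n)
      then have "(\<Sum>i<n. U (z i)) < (\<Sum>i<n. W k (z i))" by (simp add: sum_subtractf)
      also have "\<dots> \<le> (\<Sum>i<n. V (z i))" by (intro sum_mono) (simp add: W_def)
      finally show ?case .
    qed
  qed
qed

end

section \<open>Empirical minimizers\<close>

context convex_loss
begin

lemma expected_loss_count_space:
  "finite A \<Longrightarrow> expected_loss g (count_space A) x y = ennreal (\<Sum>i\<in>A. g (x i - y))"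
  unfolding expected_loss_def
  by (simp add: nn_integral_count_space_finite g_nonneg)

text \<open>
  The empirical loss is the expected loss over the counting measure on the sample indices.
\<close>
lemma empirical_argmin_localized:
  fixes X :: "nat \<Rightarrow> 'a \<Rightarrow> real"
  assumes n: "1 \<le> n" and e: "0 < e"
    and less: "(\<Sum>i=1..n. g (X i \<omega> - c)) < (\<Sum>i=1..n. g (X i \<omega> - (c + e)))"
      "(\<Sum>i=1..n. g (X i \<omega> - c)) < (\<Sum>i=1..n. g (X i \<omega> - (c - e)))"
  shows "\<bar>empirical_argmin g X n \<omega> - c\<bar> < e"
proof -
  let ?N = "count_space {1..n}" and ?x = "\<lambda>i. X i \<omega>"
  have \<xi>: "expected_loss g ?N ?x y = ennreal (\<Sum>i=1..n. g (X i \<omega> - y))" for y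
    by (rule expected_loss_count_space) simp
  interpret E: finite_measure ?N by (rule finite_measure_count_space) simp
  interpret E: finite_expected_loss g ?N ?x
  proof unfold_locales
    show "emeasure ?N (space ?N) \<noteq> 0" using n by simp
    show "\<exists>y. expected_loss g ?N ?x y < \<infinity>" unfolding \<xi> by simp
  qed simp
  have less_iff: "E.\<xi> y < E.\<xi> y' \<longleftrightarrow> (\<Sum>i=1..n. g (X i \<omega> - y)) < (\<Sum>i=1..n. g (X i \<omega> - y'))" for y y'
    unfolding \<xi> by (intro ennreal_less_iff sum_nonneg g_nonneg)
  have "empirical_argmin g X n \<omega> = argmin E.\<xi>"
    unfolding empirical_argmin_def argmin_def is_arg_min_def less_iff ..
  moreover have "\<bar>argmin E.\<xi> - c\<bar> < e"
    using less e unfolding less_iff[symmetric] by (rule E.argmin_localized)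
  ultimately show ?thesis by simp
qed

end

text \<open>
  Transfers almost sure statements on the sequence space, whose indices start at 0, to the
  sample, whose indices start at 1.
\<close>
lemma (in prob_space) iid_sequence_law:
  assumes indep: "indep_vars (\<lambda>_. borel) X {1::nat..}"
    and distr: "\<And>i. 1 \<le> i \<Longrightarrow> distr M borel (X i) = P"
  shows "distr M (\<Pi>\<^sub>M i\<in>UNIV. P) (\<lambda>\<omega> i. X (Suc i) \<omega>) = (\<Pi>\<^sub>M i\<in>UNIV. P)"
proof -
  have rv: "X i \<in> borel_measurable M" if "1 \<le> i" for i
    using indep that by (auto simp: indep_vars_def)
  have sets: "sets P = sets borel" using distr[of 1] by force
  have prob: "prob_space P" using prob_space_distr[OF rv, of 1] distr[of 1] by simp
  let ?r = "\<lambda>\<omega>. \<lambda>i\<in>{1..}. X i \<omega>" and ?s = "\<lambda>z. \<lambda>i\<in>UNIV. z (Suc i)"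
  let ?B = "\<Pi>\<^sub>M i\<in>{1::nat..}. borel :: 'b measure" and ?S = "\<Pi>\<^sub>M i\<in>(UNIV::nat set). P"
  have r: "?r \<in> M \<rightarrow>\<^sub>M ?B"
    by (rule measurable_restrict) (use rv in auto)
  have sets_B: "sets ?B = sets (\<Pi>\<^sub>M i\<in>{1::nat..}. P)"
    by (intro sets_PiM_cong) (simp_all add: sets)
  have "?s \<in> (\<Pi>\<^sub>M i\<in>{1::nat..}. P) \<rightarrow>\<^sub>M ?S"
    by (rule measurable_restrict) auto
  then have s: "?s \<in> ?B \<rightarrow>\<^sub>M ?S"
    by (simp only: measurable_cong_sets[OF sets_B refl])
  have "(\<Pi>\<^sub>M i\<in>{1::nat..}. distr M borel (X i)) = (\<Pi>\<^sub>M i\<in>{1..}. P)"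
    by (rule PiM_cong) (use distr in auto)
  then have law: "distr M ?B ?r = (\<Pi>\<^sub>M i\<in>{1..}. P)"
    using indep_vars_iff_distr_eq_PiM'[where I = "{1..}" and M' = "\<lambda>_. borel" and X = X] indep rv
    by simp
  have "?S = distr (\<Pi>\<^sub>M i\<in>{1::nat..}. P) ?S ?s"
    using distr_PiM_reindex[of "{1..}" "\<lambda>_. P" Suc "UNIV :: nat set"] prob by simp
  also have "\<dots> = distr M ?S (?s \<circ> ?r)"
    unfolding law[symmetric] by (rule distr_distr[OF s r])
  also have "?s \<circ> ?r = (\<lambda>\<omega> i. X (Suc i) \<omega>)" by (auto simp: fun_eq_iff)
  finally show ?thesis ..
qed

theorem theorem4:
  fixes g :: "real \<Rightarrow> real"
    and M :: "'a measure" and X :: "nat \<Rightarrow> 'a \<Rightarrow> real"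
    and N :: "'b measure" and Y :: "'b \<Rightarrow> real"
    and P_X :: "real measure"
  assumes g_convex: "strictly_convex g"
    and g_min: "\<And>x. g 0 \<le> g x"
    and g_0: "g 0 = 0"
    and M: "prob_space M"
    and X_indep: "prob_space.indep_vars M (\<lambda>_. borel) X {1..}"
    and X_distr: "\<And>i. i \<ge> 1 \<Longrightarrow> distr M borel (X i) = P_X"
    and N: "prob_space N"
    and Y_rv: "Y \<in> borel_measurable N"
    and Y_distr: "distr N borel Y = P_X"
    and finite_somewhere: "\<exists>x. expected_loss g N Y x < \<infinity>"
  shows "AE \<omega> in M. (\<lambda>n. empirical_argmin g X n \<omega>) \<longlonglongrightarrow> argmin (expected_loss g N Y)"
proof -
  interpret convex_loss g using g_convex g_min g_0 by unfold_locales
  interpret sample: prob_space M by (rule M)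
  interpret N: prob_space N by (rule N)
  interpret L: finite_expected_loss g N Y
    using Y_rv finite_somewhere by unfold_locales (auto simp: N.emeasure_space_1)
  have sets_P [measurable_cong]: "sets P_X = sets borel" using Y_distr by force
  have "prob_space P_X" using N.prob_space_distr[OF Y_rv] Y_distr by simp
  then interpret P: sequence_space P_X
    unfolding sequence_space_def by (intro product_prob_spaceI)
  define c where "c = argmin (expected_loss g N Y)"
  have X_rv: "X i \<in> borel_measurable M" if "1 \<le> i" for i
    using X_indep that by (auto simp: sample.indep_vars_def)
  have X_seq: "(\<lambda>\<omega> i. X (Suc i) \<omega>) \<in> M \<rightarrow>\<^sub>M P.S"
    by (rule measurable_PiM_single') 
       (use X_rv in \<open>auto simp: measurable_cong_sets[OF refl sets_P] sets_eq_imp_space_eq[OF sets_P]\<close>)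
  have loss: "(\<integral>\<^sup>+x. ennreal (g (x - y)) \<partial>P_X) = expected_loss g N Y y" for y
    unfolding expected_loss_def Y_distr[symmetric] using Y_rv by (simp add: nn_integral_distr)
  \<comment> \<open>the sample eventually prefers \<open>c\<close> to any other fixed point, also where the loss is infinite\<close>
  have separated: "AE \<omega> in M. eventually (\<lambda>n. (\<Sum>i=1..n. g (X i \<omega> - c)) < (\<Sum>i=1..n. g (X i \<omega> - y))) sequentially"
    if "y \<noteq> c" for y
  proof -
    have "AE z in P.S. eventually (\<lambda>n. (\<Sum>i<n. g (z i - c)) < (\<Sum>i<n. g (z i - y))) sequentially"
      by (rule P.larger_mean_eventually_larger_sum)
         (use L.argmin_less[of y] that in \<open>auto simp: loss g_nonneg c_def\<close>)
    then have "AE z in distr M P.S (\<lambda>\<omega> i. X (Suc i) \<omega>).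
        eventually (\<lambda>n. (\<Sum>i<n. g (z i - c)) < (\<Sum>i<n. g (z i - y))) sequentially"
      by (simp only: sample.iid_sequence_law[OF X_indep X_distr])
    from AE_distrD[OF X_seq this] show ?thesis
      by (simp add: sum.atLeast1_atMost_eq)
  qed
  define e :: "nat \<Rightarrow> real" where "e k = 1 / Suc k" for k
  have e: "0 < e k" for k by (simp add: e_def)
  have "AE \<omega> in M. eventually (\<lambda>n. \<bar>empirical_argmin g X n \<omega> - c\<bar> < e k) sequentially" for k
  proof -
    have "c + e k \<noteq> c" "c - e k \<noteq> c" using e[of k] by auto
    from separated[OF this(1)] separated[OF this(2)] show ?thesis
    proof eventually_elim
      case (elim \<omega>)
      from elim eventually_ge_at_top[of 1] show ?case
        by eventually_elim (intro empirical_argmin_localized e)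
    qed
  qed
  then have "AE \<omega> in M. \<forall>k. eventually (\<lambda>n. \<bar>empirical_argmin g X n \<omega> - c\<bar> < e k) sequentially"
    by (simp add: AE_all_countable)
  then show ?thesis
  proof eventually_elim
    case (elim \<omega>)
    show ?case unfolding c_def[symmetric]
    proof (rule tendstoI)
      fix \<epsilon> :: real assume "0 < \<epsilon>"
      then obtain k where k: "e k < \<epsilon>" unfolding e_def using nat_approx_posE by metis
      from elim have "eventually (\<lambda>n. \<bar>empirical_argmin g X n \<omega> - c\<bar> < e k) sequentially" ..
      then show "eventually (\<lambda>n. dist (empirical_argmin g X n \<omega>) c < \<epsilon>) sequentially"
        by eventually_elim (use k in \<open>simp add: dist_real_def\<close>)
    qed
  qed
qed

end
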